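(* Let $F\colon\mathbb{N}\to\mathbb{C}$, let $(f_r)_{r\in\mathbb{N}}$ be the completely even sequence of functions with $f_r(n)=F(\gcd(n,r))$ for $n,r\in\mathbb{N}$, and let $a_F$ denote the abscissa of absolute convergence of the Dirichlet series $\sum_{n=1}^{\infty}F(n)/n^s$ of $F$. Then $$\sum_{r=1}^{\infty}\frac{\widehat{f}_r(n)}{r^s}=\frac{\sigma_{s-1}(n)}{n^{s-1}\zeta(s)}\sum_{r=1}^{\infty}\frac{F(r)}{r^s}$$ for any $n\in\mathbb{N}$, absolutely convergent for $\operatorname{Re}s>\max\{1,a_F\}$; $$\sum_{n=1}^{\infty}\frac{\widehat{f}_r(n)}{n^s}=\zeta(s)\,(F*\phi_{1-s})(r)$$ for any $r\in\mathbb{N}$, absolutely convergent for $\operatorname{Re}s>1$; and $$\sum_{n=1}^{\infty}\sum_{r=1}^{\infty}\frac{\widehat{f}_r(n)}{n^s r^t}=\frac{\zeta(s)\zeta(s+t-1)}{\zeta(t)}\sum_{n=1}^{\infty}\frac{F(n)}{n^t},$$ absolutely convergent for $\operatorname{Re}s>1$, $\operatorname{Re}t>\max\{1,a_F\}$.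
   Context: $\mathbb{N}=\{1,2,\ldots\}$. For a sequence with $f_r(n)=F(\gcd(n,r))$ (called completely even), each $f_r$ is $r$-periodic and $\widehat{f}_r(n)=\sum_{k=1}^{r}f_r(k)\exp(-2\pi i kn/r)$, $n\in\mathbb{N}$, is its discrete Fourier transform. The Dirichlet convolution is $(f*g)(n)=\sum_{d\mid n}f(d)g(n/d)$; $\mu$ is the Möbius function; $\zeta$ is the Riemann zeta function. For complex $k$, $\sigma_k(n)=\sum_{d\mid n}d^k$ and $\phi_k(r)=\sum_{d\mid r}d^k\mu(r/d)$ (a generalized Euler function). *)

theory Defs
  imports
    "HOL-Analysis.Analysis"
    "HOL-Computational_Algebra.Computational_Algebra"
begin

text \<open>
  The positive integers are \<open>{1..} :: nat set\<close>; values of arithmetical functions at \<open>0\<close> are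
  never used. For \<open>n \<ge> 1\<close>, \<open>of_nat n powr s\<close> is \<open>exp (s * ln n)\<close> with the real logarithm.
\<close>

definition dft :: "nat \<Rightarrow> (nat \<Rightarrow> complex) \<Rightarrow> nat \<Rightarrow> complex" where
  "dft r g n = (\<Sum>k=1..r. g k * exp (- 2 * of_real pi * \<i> * of_nat k * of_nat n / of_nat r))"

definition dirichlet_conv :: "(nat \<Rightarrow> complex) \<Rightarrow> (nat \<Rightarrow> complex) \<Rightarrow> nat \<Rightarrow> complex" where
  "dirichlet_conv f g n = (\<Sum>d | d dvd n. f d * g (n div d))"

text \<open>The number-theoretic Moebius function (the library's \<open>moebius\<close> is a Moebius transformation).\<close>

definition moebius_mu :: "nat \<Rightarrow> int" where
  "moebius_mu n = (if squarefree n then (- 1) ^ card (prime_factors n) else 0)"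

definition divisor_sigma :: "complex \<Rightarrow> nat \<Rightarrow> complex" where
  "divisor_sigma k n = (\<Sum>d | d dvd n. of_nat d powr k)"

definition gen_phi :: "complex \<Rightarrow> nat \<Rightarrow> complex" where
  "gen_phi k r = (\<Sum>d | d dvd r. of_nat d powr k * of_int (moebius_mu (r div d)))"

text \<open>
  The Riemann zeta function on the half-plane \<open>Re s > 1\<close>, where it is given by its absolutely
  convergent Dirichlet series. Outside this half-plane the constant below is not the analytic
  continuation and must not be used as such.
\<close>

definition zeta :: "complex \<Rightarrow> complex" where
  "zeta s = (\<Sum>\<^sub>\<infinity>n\<in>{1..}. 1 / of_nat n powr s)"

text \<open>The infimum is \<open>\<infinity>\<close> if the series converges absolutely nowhere, \<open>-\<infinity>\<close> if everywhere.\<close>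

definition abs_conv_abscissa :: "(nat \<Rightarrow> complex) \<Rightarrow> ereal" where
  "abs_conv_abscissa F =
     Inf {ereal (Re s) | s. (\<lambda>n. norm (F n / of_nat n powr s)) summable_on {1..}}"

end

theory Submission
  imports Defs
begin

text \<open>
  Moebius inversion writes \<open>F\<close> as the divisor sum of \<open>G = F * \<mu>\<close> (\<open>moebius_inverse\<close>), so \<open>F (gcd k r)\<close>
  is the sum of \<open>G d\<close> over the common divisors \<open>d\<close> of \<open>k\<close> and \<open>r\<close>. The Fourier transform of the indicator
  of the multiples of \<open>d\<close> is a full geometric sum in an \<open>(r/d)\<close>-th root of unity, so it is \<open>r/d\<close> if \<open>r/d\<close>
  divides \<open>n\<close> and \<open>0\<close> otherwise. With
  \<open>q = r/d\<close> this gives (\<open>dft_even_function\<close>)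
  
    \<open>dft r (f r) n = (\<Sum>q | q dvd r \<and> q dvd n. q * G (r div q))\<close>.
  
  For fixed \<open>n\<close> the right-hand side is a Dirichlet convolution in the variable \<open>r\<close>, of a finitely
  supported function with \<open>G\<close>. For fixed \<open>r\<close> it is a Dirichlet convolution in the variable \<open>n\<close>, of
  a finitely supported function with the constant \<open>1\<close>. Dirichlet series of convolutions are products when the
  factors converge absolutely (\<open>dseries_dirichlet_conv\<close>), the series of \<open>\<mu>\<close> is \<open>1/\<zeta>\<close>, and hence that
  of \<open>G\<close> is the series of \<open>F\<close> divided by \<open>\<zeta>\<close>. The first two identities follow. The factor that depends
  on \<open>n\<close> in the first one is \<open>\<sigma>\<^bsub>1-s\<^esub>(n)\<close>, itself a convolution of a power with \<open>1\<close>, so summing it over \<open>n\<close>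
  produces the two zeta factors of the double series.
\<close>


section \<open>Dirichlet convolution and Moebius inversion\<close>

text \<open>
  For a prime \<open>p\<close> dividing \<open>n\<close>, this sign change makes the squarefree divisors of \<open>n\<close> that avoid \<open>p\<close> cancel
  against those that contain \<open>p\<close> in the divisor sum of \<open>\<mu>\<close>.
\<close>

lemma moebius_mu_prime_mult:
  assumes "prime p" "\<not> p dvd d"
  shows "moebius_mu (p * d) = - moebius_mu d"
proof -
  have cop: "coprime p d"
    using assms by (simp add: prime_imp_coprime)
  have "d \<noteq> 0"
    using assms(2) by (metis dvd_0_right)
  have "squarefree (p * d) \<longleftrightarrow> squarefree d"
    using cop assms(1) by (metis squarefree_mult_coprime squarefree_multD(2) squarefree_prime)
  moreover have "prime_factors (p * d) = insert p (prime_factors d)"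
    using assms \<open>d \<noteq> 0\<close> by (subst prime_factors_product) (auto simp: prime_prime_factors)
  moreover have "p \<notin> prime_factors d"
    using assms(2) by (simp add: in_prime_factors_iff)
  ultimately show ?thesis
    by (simp add: moebius_mu_def)
qed

lemma sum_moebius_mu_divisors:
  assumes "n \<ge> 1"
  shows "(\<Sum>d | d dvd n. moebius_mu d) = (if n = 1 then 1 else 0)"
proof (cases "n = 1")
  case True
  then show ?thesis by (simp add: moebius_mu_def)
next
  case False
  obtain p where p: "prime p" "p dvd n"
    using False prime_factor_nat by blast
  have p0: "p > 0"
    using p(1) prime_gt_0_nat by blast
  have fin: "finite {d. d dvd n}"
    using assms by simp
  \<comment> \<open>Every divisor of \<open>n\<close> lies in \<open>A\<close>, in \<open>p * A\<close>, or is divisible by \<open>p\<^sup>2\<close>, where \<open>\<mu>\<close> vanishes.\<close>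
  define A where "A = {d. d dvd n \<and> \<not> p dvd d}"
  have A: "finite A" "A \<subseteq> {d. d dvd n}"
    using fin by (auto simp: A_def)
  have "coprime p d" if "d \<in> A" for d
    using that p(1) by (simp add: A_def prime_imp_coprime)
  then have pA: "(\<lambda>d. p * d) ` A \<subseteq> {d. d dvd n}"
    using p(2) by (auto simp: A_def divides_mult)
  have inj: "inj_on (\<lambda>d. p * d) A"
    using p0 by (auto intro: inj_onI)
  have zero: "moebius_mu d = 0" if "d \<in> {d. d dvd n} - (A \<union> (\<lambda>d. p * d) ` A)" for d
  proof -
    from that have d: "d dvd n" "p dvd d"
      by (auto simp: A_def)
    then obtain e where e: "d = p * e" by blast
    then have "e dvd n"
      using d(1) by (metis dvd_mult_right)
    with that e have "p dvd e"
      by (auto simp: A_def)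
    then have "p\<^sup>2 dvd d"
      using e by (simp add: power2_eq_square)
    then have "\<not> squarefree d"
      using p(1) unfolding squarefree_def by auto
    then show ?thesis by (simp add: moebius_mu_def)
  qed
  have "(\<Sum>d | d dvd n. moebius_mu d) = (\<Sum>d\<in>A \<union> (\<lambda>d. p * d) ` A. moebius_mu d)"
    using zero A pA fin by (intro sum.mono_neutral_right) auto
  also have "\<dots> = (\<Sum>d\<in>A. moebius_mu d) + (\<Sum>d\<in>(\<lambda>d. p * d) ` A. moebius_mu d)"
  proof (rule sum.union_disjoint)
    show "A \<inter> (\<lambda>d. p * d) ` A = {}"
      by (auto simp: A_def)
  qed (simp_all add: A(1))
  also have "(\<Sum>d\<in>(\<lambda>d. p * d) ` A. moebius_mu d) = (\<Sum>d\<in>A. moebius_mu (p * d))"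
    using inj by (rule sum.reindex_cong) auto
  also have "\<dots> = (\<Sum>d\<in>A. - moebius_mu d)"
    using p(1) by (intro sum.cong) (auto simp: A_def moebius_mu_prime_mult)
  finally show ?thesis
    using False by (simp add: sum_negf)
qed

lemma abs_moebius_mu_le_1: "\<bar>moebius_mu n\<bar> \<le> 1"
  by (simp add: moebius_mu_def power_abs)

lemma dirichlet_conv_commute:
  assumes "n \<ge> 1"
  shows "dirichlet_conv f g n = dirichlet_conv g f n"
  unfolding dirichlet_conv_def using assms
  by (intro sum.reindex_bij_witness[where i = "\<lambda>d. n div d" and j = "\<lambda>d. n div d"])
     (auto simp: algebra_simps elim!: dvdE)

lemma dirichlet_conv_cong:
  assumes "n \<ge> 1" "\<And>d. d \<ge> 1 \<Longrightarrow> d dvd n \<Longrightarrow> f d = f' d" "\<And>d. d \<ge> 1 \<Longrightarrow> d dvd n \<Longrightarrow> g d = g' d"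
  shows "dirichlet_conv f g n = dirichlet_conv f' g' n"
  unfolding dirichlet_conv_def
proof (intro sum.cong refl)
  fix d assume "d \<in> {d. d dvd n}"
  then obtain e where e: "n = d * e" by auto
  then have "d \<ge> 1" "e \<ge> 1" "n div d = e"
    using assms(1) by (auto simp: Suc_le_eq)
  then show "f d * g (n div d) = f' d * g' (n div d)"
    using assms e by simp
qed

text \<open>
  Both sides sum over the factorizations of \<open>n\<close> into three factors; the left one lists them by the product
  of the first two and the first, the right one by the first and the second.
\<close>

lemma dirichlet_conv_assoc:
  assumes "n \<ge> 1"
  shows "dirichlet_conv (dirichlet_conv f g) h n = dirichlet_conv f (dirichlet_conv g h) n"
proof -
  have fin: "finite {d. d dvd m}" if "m dvd n" for m
    using assms that by (intro finite_divisors_nat) (auto intro: Nat.gr0I)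
  have "dirichlet_conv (dirichlet_conv f g) h n =
      (\<Sum>(d, a)\<in>(SIGMA d:{d. d dvd n}. {a. a dvd d}). f a * g (d div a) * h (n div d))"
    unfolding dirichlet_conv_def sum_distrib_right using fin by (subst sum.Sigma) auto
  also have "\<dots> = (\<Sum>(a, b)\<in>(SIGMA a:{a. a dvd n}. {b. b dvd n div a}). f a * (g b * h (n div a div b)))"
    using assms
    by (intro sum.reindex_bij_witness[where i = "\<lambda>(a, b). (a * b, a)" and j = "\<lambda>(d, a). (a, d div a)"])
       (auto elim!: dvdE simp: mult.assoc)
  also have "\<dots> = dirichlet_conv f (dirichlet_conv g h) n"
    unfolding dirichlet_conv_def sum_distrib_left using fin by (subst sum.Sigma) (auto elim!: dvdE)
  finally show ?thesis .
qed

definition moebius_inverse :: "(nat \<Rightarrow> complex) \<Rightarrow> nat \<Rightarrow> complex" where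
  "moebius_inverse F = dirichlet_conv F (\<lambda>n. of_int (moebius_mu n))"

lemma dirichlet_conv_moebius_one:
  assumes "n \<ge> 1"
  shows "dirichlet_conv (\<lambda>n. of_int (moebius_mu n)) (\<lambda>_. 1) n = (if n = 1 then 1 else 0)"
  using sum_moebius_mu_divisors[OF assms] by (simp add: dirichlet_conv_def flip: of_int_sum)

lemma sum_moebius_inverse_divisors:
  assumes "n \<ge> 1"
  shows "(\<Sum>d | d dvd n. moebius_inverse F d) = F n"
proof -
  have "(\<Sum>d | d dvd n. moebius_inverse F d) = dirichlet_conv (moebius_inverse F) (\<lambda>_. 1) n"
    by (simp add: dirichlet_conv_def)
  also have "\<dots> = dirichlet_conv F (dirichlet_conv (\<lambda>n. of_int (moebius_mu n)) (\<lambda>_. 1)) n"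
    unfolding moebius_inverse_def using assms by (rule dirichlet_conv_assoc)
  also have "\<dots> = dirichlet_conv F (\<lambda>n. if n = 1 then 1 else 0) n"
    using assms by (intro dirichlet_conv_cong dirichlet_conv_moebius_one) auto
  also have "\<dots> = dirichlet_conv (\<lambda>n. if n = 1 then 1 else 0) F n"
    using assms by (rule dirichlet_conv_commute)
  also have "\<dots> = (\<Sum>d | d dvd n. if d = 1 then F n else 0)"
    unfolding dirichlet_conv_def by (intro sum.cong) auto
  also have "\<dots> = F n"
    using assms by (subst sum.delta) auto
  finally show ?thesis .
qed

section \<open>The discrete Fourier transform of an even function\<close>

text \<open>
  A geometric sum whose ratio is an \<open>m\<close>-th root of unity; the ratio is \<open>1\<close> exactly when \<open>m\<close> divides \<open>n\<close>.
\<close>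

lemma sum_exp_multiples:
  assumes "m \<ge> 1"
  shows "(\<Sum>j=1..m. exp (- 2 * of_real pi * \<i> * of_nat j * of_nat n / of_nat m)) =
    (if m dvd n then of_nat m else (0::complex))"
proof -
  define w where "w = exp (- 2 * of_real pi * \<i> * of_nat n / (of_nat m :: complex))"
  have w: "exp (- 2 * of_real pi * \<i> * of_nat j * of_nat n / of_nat m) = w ^ j" for j
  proof -
    have "- 2 * of_real pi * \<i> * of_nat j * of_nat n / of_nat m =
        of_nat j * (- 2 * of_real pi * \<i> * of_nat n / (of_nat m :: complex))"
      by (simp add: mult_ac)
    then show ?thesis
      unfolding w_def by (simp only: exp_of_nat_mult)
  qed
  have wm: "w ^ m = 1"
  proof -
    have "w ^ m = exp (of_nat m * (- 2 * of_real pi * \<i> * of_nat n / of_nat m))"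
      unfolding w_def by (rule exp_of_nat_mult [symmetric])
    also have "of_nat m * (- 2 * of_real pi * \<i> * of_nat n / of_nat m) =
        (of_real (2 * of_int (- int n) * pi) * \<i> :: complex)"
      using assms by simp
    also have "exp \<dots> = 1"
      by (rule exp_integer_2pi) auto
    finally show ?thesis .
  qed
  have w1: "w = 1 \<longleftrightarrow> m dvd n"
  proof
    assume "m dvd n"
    then obtain k where "n = m * k" ..
    then have "- 2 * of_real pi * \<i> * of_nat n / of_nat m =
        (of_real (2 * of_int (- int k) * pi) * \<i> :: complex)"
      using assms by simp
    then have "w = exp (of_real (2 * of_int (- int k) * pi) * \<i>)"
      unfolding w_def by (simp only:)
    also have "\<dots> = 1"
      by (rule exp_integer_2pi) auto
    finally show "w = 1" .
  next
    assume "w = 1"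
    then obtain k :: int where "- 2 * pi * n / m = of_int (2 * k) * pi"
      unfolding w_def exp_eq_1 by auto
    then have "pi * real_of_int (- int n) = pi * of_int (k * int m)"
      using assms by (simp add: field_simps)
    then have "real_of_int (- int n) = of_int (k * int m)"
      by (metis mult_cancel_left pi_neq_zero)
    then have "- int n = k * int m"
      by (simp only: of_int_eq_iff)
    then have "int m dvd - int n" by simp
    then show "m dvd n" by simp
  qed
  have "(\<Sum>j=1..m. w ^ j) = w * (\<Sum>j<m. w ^ j)"
    by (simp add: sum_distrib_left sum.atLeast1_atMost_eq lessThan_atLeast0)
  also have "\<dots> = (if m dvd n then of_nat m else 0)"
    using w1 wm geometric_sum[of w m] by auto
  finally show ?thesis by (simp only: w)
qed

text \<open>
  Inserting the Moebius expansion of \<open>F (gcd k r)\<close> and exchanging sums leaves, for each \<open>d\<close> dividing \<open>r\<close>, the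
  exponential sum over the multiples \<open>k = d * j\<close> of \<open>d\<close>.
  That is the sum of \<open>sum_exp_multiples\<close> with \<open>m = r/d\<close>.
  For \<open>F\<close> the indicator of \<open>1\<close> the result is the evaluation of Ramanujan sums.
\<close>

lemma dft_even_function:
  assumes f_eq: "\<And>k. k \<ge> 1 \<Longrightarrow> g k = F (gcd k r)" and r: "r \<ge> 1"
  shows "dft r g n = (\<Sum>q | q dvd r \<and> q dvd n. of_nat q * moebius_inverse F (r div q))"
proof -
  define e where "e k = exp (- 2 * of_real pi * \<i> * of_nat k * of_nat n / (of_nat r :: complex))" for k
  have fin: "finite {d. d dvd r}"
    using r by simp
  have inner: "(\<Sum>k | k \<in> {1..r} \<and> d dvd k. e k) = (if r div d dvd n then of_nat (r div d) else 0)"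
    if "d dvd r" for d
  proof -
    from that obtain m where m: "r = d * m" ..
    with r have dm: "d \<ge> 1" "m \<ge> 1" by (auto simp: Suc_le_eq)
    have "(\<Sum>k | k \<in> {1..r} \<and> d dvd k. e k) = (\<Sum>j=1..m. e (d * j))"
      by (rule sum.reindex_bij_witness[where i = "\<lambda>j. d * j" and j = "\<lambda>k. k div d"])
         (use dm m in \<open>auto elim!: dvdE simp: Suc_le_eq\<close>)
    also have "\<dots> = (\<Sum>j=1..m. exp (- 2 * of_real pi * \<i> * of_nat j * of_nat n / of_nat m))"
      unfolding e_def m using dm by (intro sum.cong refl arg_cong[where f = exp]) (simp add: field_simps)
    also have "\<dots> = (if m dvd n then of_nat m else 0)"
      using dm(2) by (rule sum_exp_multiples)
    finally show ?thesis
      using dm m by simp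
  qed
  have "dft r g n = (\<Sum>k=1..r. (\<Sum>d | d dvd r. if d dvd k then moebius_inverse F d * e k else 0))"
    unfolding dft_def
  proof (intro sum.cong refl)
    fix k assume "k \<in> {1..r}"
    then have k: "k \<ge> 1" "gcd k r \<ge> 1" by (auto simp: Suc_le_eq)
    have "g k = (\<Sum>d | d dvd gcd k r. moebius_inverse F d)"
      using k by (simp only: f_eq sum_moebius_inverse_divisors)
    then have "g k * e k = (\<Sum>d | d dvd gcd k r. moebius_inverse F d * e k)"
      by (simp add: sum_distrib_right)
    also have "\<dots> = (\<Sum>d | d dvd r. if d dvd k then moebius_inverse F d * e k else 0)"
    proof -
      have "{d. d dvd gcd k r} = {d \<in> {d. d dvd r}. d dvd k}"
        by auto
      then show ?thesis
        by (simp only: sum.inter_filter[OF fin])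
    qed
    finally show "g k * exp (- 2 * of_real pi * \<i> * of_nat k * of_nat n / of_nat r) =
        (\<Sum>d | d dvd r. if d dvd k then moebius_inverse F d * e k else 0)"
      by (simp add: e_def)
  qed
  also have "\<dots> = (\<Sum>d | d dvd r. \<Sum>k=1..r. if d dvd k then moebius_inverse F d * e k else 0)"
    by (rule sum.swap)
  also have "\<dots> = (\<Sum>d | d dvd r. moebius_inverse F d * (\<Sum>k | k \<in> {1..r} \<and> d dvd k. e k))"
    unfolding sum.inter_filter[OF finite_atLeastAtMost] sum_distrib_left
    by (intro sum.cong refl) auto
  also have "\<dots> = (\<Sum>d | d dvd r. if r div d dvd n then of_nat (r div d) * moebius_inverse F d else 0)"
    by (intro sum.cong refl, subst inner) auto
  also have "\<dots> = (\<Sum>q | q dvd r. if q dvd n then of_nat q * moebius_inverse F (r div q) else 0)"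
    using r by (intro sum.reindex_bij_witness[where i = "\<lambda>d. r div d" and j = "\<lambda>d. r div d"])
      (auto elim!: dvdE)
  also have "\<dots> = (\<Sum>q | q dvd r \<and> q dvd n. of_nat q * moebius_inverse F (r div q))"
  proof -
    have "{q. q dvd r \<and> q dvd n} = {q \<in> {q. q dvd r}. q dvd n}"
      by auto
    then show ?thesis
      by (simp only: sum.inter_filter[OF fin])
  qed
  finally show ?thesis .
qed

section \<open>Products of absolutely convergent Dirichlet series\<close>

text \<open>
  The absolutely convergent double sum of \<open>u a * v b\<close> is regrouped along the hyperbolas \<open>a * b = n\<close>.
  The generality in the field allows the use of the same identity for the series of norms, which gives the majorants.
\<close>

lemma has_sum_divisor_convolution:
  fixes u v :: "nat \<Rightarrow> 'a :: {banach, real_normed_field}"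
  assumes u: "(\<lambda>n. norm (u n)) summable_on {1..}" and v: "(\<lambda>n. norm (v n)) summable_on {1..}"
  shows "((\<lambda>n. \<Sum>d | d dvd n. u d * v (n div d)) has_sum (infsum u {1..} * infsum v {1..})) {1..}"
proof -
  let ?P = "\<lambda>(a, b). u a * v b"
  have "0 \<le> (\<Sum>\<^sub>\<infinity>b\<in>{1..}. norm (v b))"
    by (rule infsum_nonneg) auto
  then have "(\<lambda>a. norm (\<Sum>\<^sub>\<infinity>b\<in>{1..}. norm (u a * v b))) summable_on {1..}"
    using summable_on_cmult_left[OF u] by (simp add: norm_mult infsum_cmult_right' abs_mult)
  moreover have "(\<lambda>b. norm (u a * v b)) summable_on {1..}" for a
    using summable_on_cmult_right[OF v] by (simp add: norm_mult)
  ultimately have "(\<lambda>p. norm (?P p)) summable_on {1..} \<times> {1..}"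
    unfolding Infinite_Sum.abs_summable_on_Sigma_iff by simp
  then have "?P summable_on {1..} \<times> {1..}"
    by (rule abs_summable_summable)
  moreover have "((\<lambda>b. u a * v b) has_sum (u a * infsum v {1..})) {1..}" for a
    by (intro has_sum_cmult_right has_sum_infsum abs_summable_summable[OF v])
  moreover have "((\<lambda>a. u a * infsum v {1..}) has_sum (infsum u {1..} * infsum v {1..})) {1..}"
    by (intro has_sum_cmult_left has_sum_infsum abs_summable_summable[OF u])
  ultimately have "(?P has_sum (infsum u {1..} * infsum v {1..})) ({1..} \<times> {1..})"
    by (intro has_sum_SigmaI[where g = "\<lambda>a. u a * infsum v {1..}"]) simp_all
  also have "?this \<longleftrightarrow> ((\<lambda>(n, d). u d * v (n div d)) has_sum (infsum u {1..} * infsum v {1..}))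
      (SIGMA n:{1..}. {d. d dvd n})"
    by (rule has_sum_reindex_bij_witness[where
          i = "\<lambda>(n, d). (d, n div d)" and j = "\<lambda>(a, b). (a * b, a)"])
       (auto elim!: dvdE simp: Suc_le_eq)
  finally show ?thesis
    by (rule has_sum_SigmaD) (auto intro!: has_sum_finiteI)
qed

definition dseries :: "(nat \<Rightarrow> complex) \<Rightarrow> complex \<Rightarrow> complex" where
  "dseries f s = (\<Sum>\<^sub>\<infinity>n\<in>{1..}. f n / of_nat n powr s)"

definition abs_conv :: "(nat \<Rightarrow> complex) \<Rightarrow> complex \<Rightarrow> bool" where
  "abs_conv f s \<longleftrightarrow> (\<lambda>n. norm (f n / of_nat n powr s)) summable_on {1..}"

lemma dseries_cong:
  assumes "\<And>n. n \<ge> 1 \<Longrightarrow> f n = g n"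
  shows "dseries f s = dseries g s" "abs_conv f s \<longleftrightarrow> abs_conv g s"
  using assms by (auto simp: dseries_def abs_conv_def intro!: infsum_cong summable_on_cong)

lemma of_nat_mult_powr:
  "of_nat (a * b) powr s = of_nat a powr s * (of_nat b powr s :: complex)"
  by (simp add: powr_times_real)

lemma norm_of_nat_powr: "norm (of_nat n powr s :: complex) = real n powr Re s"
  by (simp add: norm_powr_real_powr)

lemma dirichlet_conv_div_powr:
  assumes "n \<ge> 1"
  shows "dirichlet_conv (\<lambda>n. f n / of_nat n powr s) (\<lambda>n. g n / of_nat n powr s) n =
    dirichlet_conv f g n / of_nat n powr s"
  unfolding dirichlet_conv_def sum_divide_distrib
proof (intro sum.cong refl)
  fix d assume "d \<in> {d. d dvd n}"
  then obtain e where e: "n = d * e" by auto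
  with assms have "n div d = e" by auto
  then show "f d / of_nat d powr s * (g (n div d) / of_nat (n div d) powr s) =
      f d * g (n div d) / of_nat n powr s"
    unfolding e of_nat_mult_powr by simp
qed

text \<open>
  Multiplicativity comes from \<open>has_sum_divisor_convolution\<close> applied to the terms, and the bound on the series
  of norms from applying it to their norms. The quantitative bound is needed to sum the absolute values of the
  double series first in one variable and then in the other.
\<close>

lemma dseries_dirichlet_conv:
  assumes "abs_conv f s" "abs_conv g s"
  shows "dseries (dirichlet_conv f g) s = dseries f s * dseries g s"
    and "abs_conv (dirichlet_conv f g) s"
    and "(\<Sum>\<^sub>\<infinity>n\<in>{1..}. norm (dirichlet_conv f g n / of_nat n powr s)) \<le>
      (\<Sum>\<^sub>\<infinity>n\<in>{1..}. norm (f n / of_nat n powr s)) * (\<Sum>\<^sub>\<infinity>n\<in>{1..}. norm (g n / of_nat n powr s))"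
proof -
  define u where "u n = f n / of_nat n powr s" for n
  define v where "v n = g n / of_nat n powr s" for n
  have u: "(\<lambda>n. norm (u n)) summable_on {1..}" and v: "(\<lambda>n. norm (v n)) summable_on {1..}"
    using assms by (auto simp: abs_conv_def u_def v_def)
  have conv: "(\<Sum>d | d dvd n. u d * v (n div d)) = dirichlet_conv f g n / of_nat n powr s" if "n \<ge> 1" for n
    using dirichlet_conv_div_powr[OF that, of f s g]
    by (simp add: dirichlet_conv_def u_def v_def)
  have "((\<lambda>n. \<Sum>d | d dvd n. u d * v (n div d)) has_sum (infsum u {1..} * infsum v {1..})) {1..}"
    using u v by (rule has_sum_divisor_convolution)
  then have "((\<lambda>n. dirichlet_conv f g n / of_nat n powr s) has_sum (infsum u {1..} * infsum v {1..})) {1..}"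
    by (rule has_sum_cong[THEN iffD1, rotated]) (simp add: conv)
  then show "dseries (dirichlet_conv f g) s = dseries f s * dseries g s"
    unfolding dseries_def u_def v_def by (rule infsumI)
  have maj: "((\<lambda>n. \<Sum>d | d dvd n. norm (u d) * norm (v (n div d))) has_sum
      ((\<Sum>\<^sub>\<infinity>n\<in>{1..}. norm (u n)) * (\<Sum>\<^sub>\<infinity>n\<in>{1..}. norm (v n)))) {1..}"
    using u v by (intro has_sum_divisor_convolution) auto
  have le: "norm (dirichlet_conv f g n / of_nat n powr s) \<le> (\<Sum>d | d dvd n. norm (u d) * norm (v (n div d)))"
    if "n \<in> {1..}" for n
  proof -
    have "norm (\<Sum>d | d dvd n. u d * v (n div d)) \<le> (\<Sum>d | d dvd n. norm (u d * v (n div d)))"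
      by (rule norm_sum)
    then show ?thesis
      using that by (simp only: conv atLeast_iff norm_mult)
  qed
  show ac: "abs_conv (dirichlet_conv f g) s"
    unfolding abs_conv_def
    by (rule summable_on_comparison_test[OF has_sum_imp_summable[OF maj] le]) auto
  have "(\<Sum>\<^sub>\<infinity>n\<in>{1..}. norm (dirichlet_conv f g n / of_nat n powr s)) \<le>
      (\<Sum>\<^sub>\<infinity>n\<in>{1..}. \<Sum>d | d dvd n. norm (u d) * norm (v (n div d)))"
    using ac has_sum_imp_summable[OF maj] le unfolding abs_conv_def by (rule infsum_mono)
  then show "(\<Sum>\<^sub>\<infinity>n\<in>{1..}. norm (dirichlet_conv f g n / of_nat n powr s)) \<le>
      (\<Sum>\<^sub>\<infinity>n\<in>{1..}. norm (f n / of_nat n powr s)) * (\<Sum>\<^sub>\<infinity>n\<in>{1..}. norm (g n / of_nat n powr s))"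
    using infsumI[OF maj] by (simp add: u_def v_def)
qed

lemma abs_conv_comparison:
  assumes "abs_conv g s0" "\<And>n. n \<ge> 1 \<Longrightarrow> norm (f n) \<le> norm (g n)" "Re s0 \<le> Re s"
  shows "abs_conv f s"
  unfolding abs_conv_def
proof (rule summable_on_comparison_test)
  show "(\<lambda>n. norm (g n / of_nat n powr s0)) summable_on {1..}"
    using assms(1) by (simp add: abs_conv_def)
  show "norm (f n / of_nat n powr s) \<le> norm (g n / of_nat n powr s0)" if "n \<in> {1..}" for n
    unfolding norm_divide norm_of_nat_powr using that assms(2,3)
    by (intro frac_le powr_mono) auto
qed auto

lemma abs_conv_if_abscissa_less:
  assumes "ereal (Re s) > abs_conv_abscissa f"
  shows "abs_conv f s"
proof -
  from assms obtain s0 where "abs_conv f s0" "Re s0 < Re s"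
    unfolding abs_conv_abscissa_def Inf_less_iff abs_conv_def by auto
  then show ?thesis
    by (intro abs_conv_comparison[of f s0 f s]) auto
qed

lemma abs_conv_one:
  assumes "Re s > 1"
  shows "abs_conv (\<lambda>_. 1) s"
proof -
  have "summable (\<lambda>n. real n powr (- Re s))"
    using assms by (subst summable_real_powr_iff) auto
  then have "(\<lambda>n. real n powr (- Re s)) summable_on UNIV"
    by (intro norm_summable_imp_summable_on) auto
  then have "(\<lambda>n. real n powr (- Re s)) summable_on {1..}"
    by (rule summable_on_subset_banach) auto
  then show ?thesis
    by (simp add: abs_conv_def norm_divide norm_of_nat_powr powr_minus_divide)
qed

lemma zeta_eq_dseries: "zeta s = dseries (\<lambda>_. 1) s"
  by (simp add: zeta_def dseries_def)

lemma dseries_powr: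
  "dseries (\<lambda>n. of_nat n powr k) s = zeta (s - k)"
  "abs_conv (\<lambda>n. of_nat n powr k) s \<longleftrightarrow> abs_conv (\<lambda>_. 1) (s - k)"
proof -
  have "of_nat n powr k / of_nat n powr s = 1 / (of_nat n powr (s - k) :: complex)" for n :: nat
    by (simp add: powr_diff)
  then show "dseries (\<lambda>n. of_nat n powr k) s = zeta (s - k)"
    "abs_conv (\<lambda>n. of_nat n powr k) s \<longleftrightarrow> abs_conv (\<lambda>_. 1) (s - k)"
    by (simp_all add: zeta_eq_dseries dseries_def abs_conv_def)
qed

lemma dseries_divisor_support:
  assumes "m \<ge> 1"
  shows "dseries (\<lambda>q. if q dvd m then c q else 0) s = (\<Sum>q | q dvd m. c q / of_nat q powr s)"
    and "(\<Sum>\<^sub>\<infinity>q\<in>{1..}. norm ((if q dvd m then c q else 0) / of_nat q powr s)) =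
      (\<Sum>q | q dvd m. norm (c q / of_nat q powr s))"
    and "abs_conv (\<lambda>q. if q dvd m then c q else 0) s"
proof -
  have D: "finite {q. q dvd m}" "{q. q dvd m} \<subseteq> {1..}"
    using assms by (auto intro: Nat.gr0I simp: Suc_le_eq)
  have 1: "((\<lambda>q. (if q dvd m then c q else 0) / of_nat q powr s) has_sum
      (\<Sum>q | q dvd m. c q / of_nat q powr s)) {1..}"
    using D by (rule has_sum_finite_neutralI) auto
  then show "dseries (\<lambda>q. if q dvd m then c q else 0) s = (\<Sum>q | q dvd m. c q / of_nat q powr s)"
    unfolding dseries_def by (rule infsumI)
  have 2: "((\<lambda>q. norm ((if q dvd m then c q else 0) / of_nat q powr s)) has_sum
      (\<Sum>q | q dvd m. norm (c q / of_nat q powr s))) {1..}"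
    using D by (rule has_sum_finite_neutralI) auto
  then show "(\<Sum>\<^sub>\<infinity>q\<in>{1..}. norm ((if q dvd m then c q else 0) / of_nat q powr s)) =
      (\<Sum>q | q dvd m. norm (c q / of_nat q powr s))"
    by (rule infsumI)
  show "abs_conv (\<lambda>q. if q dvd m then c q else 0) s"
    unfolding abs_conv_def using 2 by (rule has_sum_imp_summable)
qed

lemma dseries_delta: "dseries (\<lambda>n. if n = 1 then 1 else 0) s = 1"
  using dseries_divisor_support(1)[of 1 "\<lambda>_. 1" s] by simp

lemma abs_conv_moebius:
  assumes "Re s > 1"
  shows "abs_conv (\<lambda>n. of_int (moebius_mu n)) s"
proof (rule abs_conv_comparison[OF abs_conv_one[OF assms]])
  show "norm (of_int (moebius_mu n) :: complex) \<le> norm (1 :: complex)" for n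
    using abs_moebius_mu_le_1[of n] by (simp flip: of_int_abs)
qed simp

text \<open>
  The identity \<open>\<mu> * 1 = \<delta>\<close> in terms of series. It also shows that \<open>\<zeta>\<close> has no zero in this half-plane.
\<close>

lemma dseries_moebius_mult_zeta:
  assumes "Re s > 1"
  shows "dseries (\<lambda>n. of_int (moebius_mu n)) s * zeta s = 1"
proof -
  let ?M = "\<lambda>n. of_int (moebius_mu n) :: complex"
  have "dseries ?M s * zeta s = dseries (dirichlet_conv ?M (\<lambda>_. 1)) s"
    unfolding zeta_eq_dseries
    by (rule dseries_dirichlet_conv(1)[OF abs_conv_moebius[OF assms] abs_conv_one[OF assms], symmetric])
  also have "\<dots> = dseries (\<lambda>n. if n = 1 then 1 else 0) s"
    by (rule dseries_cong(1)[OF dirichlet_conv_moebius_one])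
  also have "\<dots> = 1"
    by (rule dseries_delta)
  finally show ?thesis .
qed

lemma dseries_moebius_inverse:
  assumes "Re s > 1" "abs_conv F s"
  shows "dseries (moebius_inverse F) s = dseries F s / zeta s" "abs_conv (moebius_inverse F) s"
proof -
  have "zeta s \<noteq> 0"
    using dseries_moebius_mult_zeta[OF assms(1)] by auto
  then have "dseries (\<lambda>n. of_int (moebius_mu n)) s = 1 / zeta s"
    using dseries_moebius_mult_zeta[OF assms(1)] by (simp add: nonzero_eq_divide_eq)
  then show "dseries (moebius_inverse F) s = dseries F s / zeta s"
    unfolding moebius_inverse_def
    using dseries_dirichlet_conv(1)[OF assms(2) abs_conv_moebius[OF assms(1)]] by simp
  show "abs_conv (moebius_inverse F) s"
    unfolding moebius_inverse_def
    using dseries_dirichlet_conv(2)[OF assms(2) abs_conv_moebius[OF assms(1)]] .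
qed

section \<open>The three series\<close>

lemma of_nat_div_powr: "of_nat q / of_nat q powr s = (of_nat q powr (1 - s) :: complex)"
  by (cases "q = 0") (auto simp: powr_diff)

text \<open>
  The involution \<open>d \<mapsto> n/d\<close> of the divisors of \<open>n\<close>.
\<close>

lemma divisor_sigma_reflect:
  assumes "n \<ge> 1"
  shows "divisor_sigma (- k) n = divisor_sigma k n / of_nat n powr k"
proof -
  have "divisor_sigma k n / of_nat n powr k = (\<Sum>d | d dvd n. of_nat d powr k / of_nat n powr k)"
    by (simp add: divisor_sigma_def sum_divide_distrib)
  also have "\<dots> = (\<Sum>d | d dvd n. of_nat (n div d) powr (- k))"
  proof (intro sum.cong refl)
    fix d assume "d \<in> {d. d dvd n}"
    then obtain e where e: "n = d * e" by auto
    with assms have "d \<noteq> 0" "e \<noteq> 0" "n div d = e" by auto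
    then show "of_nat d powr k / of_nat n powr k = (of_nat (n div d) powr (- k) :: complex)"
      unfolding e of_nat_mult_powr by (simp add: powr_minus_divide)
  qed
  also have "\<dots> = divisor_sigma (- k) n"
    using dirichlet_conv_commute[OF assms, of "\<lambda>_. 1" "\<lambda>d. of_nat d powr (- k)"]
    by (simp add: divisor_sigma_def dirichlet_conv_def)
  finally show ?thesis ..
qed

text \<open>
  The divisor sum of \<open>dft_even_function\<close> can be read as a convolution in the period \<open>r\<close>
  (the condition \<open>q dvd n\<close> goes into the first factor) or in the frequency \<open>n\<close> (the condition \<open>q dvd r\<close> does).
\<close>

lemma dft_eq_dirichlet_conv_period:
  assumes "\<And>k. k \<ge> 1 \<Longrightarrow> g k = F (gcd k r)" "r \<ge> 1"
  shows "dft r g n = dirichlet_conv (\<lambda>q. if q dvd n then of_nat q else 0) (moebius_inverse F) r"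
proof -
  have fin: "finite {q. q dvd r}"
    using assms(2) by simp
  have "dft r g n = (\<Sum>q | q \<in> {q. q dvd r} \<and> q dvd n. of_nat q * moebius_inverse F (r div q))"
    using dft_even_function[of g F r n, OF assms] by simp
  then show ?thesis
    unfolding sum.inter_filter[OF fin] dirichlet_conv_def by (auto intro!: sum.cong)
qed

lemma dft_eq_dirichlet_conv_frequency:
  assumes "\<And>k. k \<ge> 1 \<Longrightarrow> g k = F (gcd k r)" "r \<ge> 1" "n \<ge> 1"
  shows "dft r g n =
    dirichlet_conv (\<lambda>q. if q dvd r then of_nat q * moebius_inverse F (r div q) else 0) (\<lambda>_. 1) n"
proof -
  have fin: "finite {q. q dvd n}"
    using assms(3) by simp
  have "dft r g n = (\<Sum>q | q \<in> {q. q dvd n} \<and> q dvd r. of_nat q * moebius_inverse F (r div q))"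
    using dft_even_function[of g F r n, OF assms(1,2)] by (simp add: conj_commute)
  then show ?thesis
    unfolding sum.inter_filter[OF fin] dirichlet_conv_def by (auto intro!: sum.cong)
qed

lemma dseries_dft_period:
  assumes f_eq: "\<And>r n. r \<ge> 1 \<Longrightarrow> n \<ge> 1 \<Longrightarrow> f r n = F (gcd n r)"
    and n: "n \<ge> 1" and s: "Re s > 1" "abs_conv F s"
  shows "abs_conv (\<lambda>r. dft r (f r) n) s"
    and "dseries (\<lambda>r. dft r (f r) n) s = divisor_sigma (1 - s) n * (dseries F s / zeta s)"
    and "(\<Sum>\<^sub>\<infinity>r\<in>{1..}. norm (dft r (f r) n / of_nat r powr s)) \<le>
      (\<Sum>q | q dvd n. norm (of_nat q / of_nat q powr s :: complex)) *
      (\<Sum>\<^sub>\<infinity>r\<in>{1..}. norm (moebius_inverse F r / of_nat r powr s))"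
proof -
  let ?a = "\<lambda>q. if q dvd n then of_nat q else (0 :: complex)"
  have eq: "dft r (f r) n = dirichlet_conv ?a (moebius_inverse F) r" if "r \<ge> 1" for r
    using that by (intro dft_eq_dirichlet_conv_period) (auto simp: f_eq)
  note a = dseries_divisor_support[OF n, of "of_nat" s]
  note G = dseries_moebius_inverse[OF s]
  note conv = dseries_dirichlet_conv[OF a(3) G(2)]
  show "abs_conv (\<lambda>r. dft r (f r) n) s"
    using conv(2) by (subst dseries_cong(2)[OF eq]) auto
  have "dseries (\<lambda>r. dft r (f r) n) s = dseries (dirichlet_conv ?a (moebius_inverse F)) s"
    by (rule dseries_cong(1)[OF eq])
  also have "\<dots> = divisor_sigma (1 - s) n * (dseries F s / zeta s)"
    by (simp only: conv(1) a(1) G(1) of_nat_div_powr divisor_sigma_def)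
  finally show "dseries (\<lambda>r. dft r (f r) n) s = divisor_sigma (1 - s) n * (dseries F s / zeta s)" .
  have "(\<Sum>\<^sub>\<infinity>r\<in>{1..}. norm (dft r (f r) n / of_nat r powr s)) =
      (\<Sum>\<^sub>\<infinity>r\<in>{1..}. norm (dirichlet_conv ?a (moebius_inverse F) r / of_nat r powr s))"
    by (intro infsum_cong) (simp add: eq)
  also have "\<dots> \<le> (\<Sum>q | q dvd n. norm (of_nat q / of_nat q powr s :: complex)) *
      (\<Sum>\<^sub>\<infinity>r\<in>{1..}. norm (moebius_inverse F r / of_nat r powr s))"
    using conv(3) by (simp only: a(2))
  finally show "(\<Sum>\<^sub>\<infinity>r\<in>{1..}. norm (dft r (f r) n / of_nat r powr s)) \<le> \<dots>" .
qed

text \<open>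
  The finite factor of the series is \<open>\<Sum>\<^bsub>q dvd r\<^esub> q\<^bsup>1-s\<^esup> G(r/q)\<close>, which is the value at \<open>r\<close> of the convolution
  of \<open>q \<mapsto> q\<^bsup>1-s\<^esup>\<close>, \<open>F\<close> and \<open>\<mu>\<close>. Grouping the power with \<open>\<mu>\<close> instead of \<open>F\<close> with \<open>\<mu>\<close> gives \<open>F * \<phi>\<^bsub>1-s\<^esub>\<close>.
\<close>

lemma dseries_dft_frequency:
  assumes f_eq: "\<And>r n. r \<ge> 1 \<Longrightarrow> n \<ge> 1 \<Longrightarrow> f r n = F (gcd n r)"
    and r: "r \<ge> 1" and s: "Re s > 1"
  shows "abs_conv (\<lambda>n. dft r (f r) n) s"
    and "dseries (\<lambda>n. dft r (f r) n) s = zeta s * dirichlet_conv F (gen_phi (1 - s)) r"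
proof -
  let ?b = "\<lambda>q. if q dvd r then of_nat q * moebius_inverse F (r div q) else 0"
  let ?P = "\<lambda>q. of_nat q powr (1 - s) :: complex"
  let ?M = "\<lambda>n. of_int (moebius_mu n) :: complex"
  have eq: "dft r (f r) n = dirichlet_conv ?b (\<lambda>_. 1) n" if "n \<ge> 1" for n
    using that r by (intro dft_eq_dirichlet_conv_frequency) (auto simp: f_eq)
  note b = dseries_divisor_support[OF r, of "\<lambda>q. of_nat q * moebius_inverse F (r div q)" s]
  note conv = dseries_dirichlet_conv[OF b(3) abs_conv_one[OF s]]
  show "abs_conv (\<lambda>n. dft r (f r) n) s"
    using conv(2) by (subst dseries_cong(2)[OF eq]) auto
  have phi: "gen_phi (1 - s) = dirichlet_conv ?P ?M"
    by (simp add: fun_eq_iff gen_phi_def dirichlet_conv_def)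
  have "(\<Sum>q | q dvd r. of_nat q * moebius_inverse F (r div q) / of_nat q powr s) =
      dirichlet_conv ?P (dirichlet_conv F ?M) r"
    unfolding dirichlet_conv_def[of ?P] moebius_inverse_def by (simp flip: of_nat_div_powr)
  also have "\<dots> = dirichlet_conv (dirichlet_conv ?P F) ?M r"
    using r by (simp only: dirichlet_conv_assoc)
  also have "\<dots> = dirichlet_conv (dirichlet_conv F ?P) ?M r"
    using r by (intro dirichlet_conv_cong dirichlet_conv_commute) auto
  also have "\<dots> = dirichlet_conv F (gen_phi (1 - s)) r"
    using r by (simp only: dirichlet_conv_assoc phi)
  finally have sum_eq: "(\<Sum>q | q dvd r. of_nat q * moebius_inverse F (r div q) / of_nat q powr s) =
      dirichlet_conv F (gen_phi (1 - s)) r" .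
  have "dseries (\<lambda>n. dft r (f r) n) s = dseries (dirichlet_conv ?b (\<lambda>_. 1)) s"
    by (rule dseries_cong(1)[OF eq])
  also have "\<dots> = zeta s * dirichlet_conv F (gen_phi (1 - s)) r"
    by (simp only: conv(1) b(1) sum_eq mult.commute flip: zeta_eq_dseries)
  finally show "dseries (\<lambda>n. dft r (f r) n) s = zeta s * dirichlet_conv F (gen_phi (1 - s)) r" .
qed

lemma dseries_divisor_sigma:
  assumes "Re s > 1" "Re (s - k) > 1"
  shows "dseries (divisor_sigma k) s = zeta s * zeta (s - k)"
proof -
  have "divisor_sigma k = dirichlet_conv (\<lambda>n. of_nat n powr k) (\<lambda>_. 1)"
    by (simp add: fun_eq_iff divisor_sigma_def dirichlet_conv_def)
  moreover have "abs_conv (\<lambda>n. of_nat n powr k) s"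
    using assms(2) by (simp only: dseries_powr abs_conv_one)
  ultimately show ?thesis
    using dseries_dirichlet_conv(1)[OF _ abs_conv_one[OF assms(1)]]
    by (simp add: dseries_powr(1) mult.commute flip: zeta_eq_dseries)
qed

text \<open>
  For absolute convergence, the sum over \<open>r\<close> of the norms is at most a constant times a divisor sum in \<open>n\<close>,
  by \<open>dseries_dft_period\<close>. After division by \<open>n\<^bsup>Re s\<^esup>\<close> that divisor sum is again a convolution of two
  summable sequences, with exponents \<open>Re (s + t) - 1\<close> and \<open>Re s\<close>, both greater than \<open>1\<close>.
\<close>

lemma dseries_dft_double:
  assumes f_eq: "\<And>r n. r \<ge> 1 \<Longrightarrow> n \<ge> 1 \<Longrightarrow> f r n = F (gcd n r)"
    and s: "Re s > 1" and t: "Re t > 1" "abs_conv F t"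
  shows "(\<lambda>(n, r). norm (dft r (f r) n / (of_nat n powr s * of_nat r powr t))) summable_on ({1..} \<times> {1..})"
    and "(\<Sum>\<^sub>\<infinity>n\<in>{1..}. \<Sum>\<^sub>\<infinity>r\<in>{1..}. dft r (f r) n / (of_nat n powr s * of_nat r powr t)) =
      zeta s * zeta (s + t - 1) / zeta t * dseries F t"
proof -
  define h where "h n r = dft r (f r) n / of_nat r powr t" for n r
  have h: "dft r (f r) n / (of_nat n powr s * of_nat r powr t) = h n r / of_nat n powr s" for n r
    by (simp add: h_def)
  note inner = dseries_dft_period[of f F _ t, OF f_eq _ t]
  have h_sum: "(\<lambda>r. norm (h n r)) summable_on {1..}" if "n \<ge> 1" for n
    using inner(1)[OF _ _ that] by (simp add: abs_conv_def h_def)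
  define C where "C = (\<Sum>\<^sub>\<infinity>r\<in>{1..}. norm (moebius_inverse F r / of_nat r powr t))"
  define u where "u q = norm (of_nat q / of_nat q powr t / of_nat q powr s :: complex)" for q :: nat
  define v where "v q = norm (1 / of_nat q powr s :: complex)" for q :: nat
  have "abs_conv (\<lambda>q. of_nat q powr (1 - t)) s"
    unfolding dseries_powr using s t(1) by (intro abs_conv_one) simp
  then have u: "(\<lambda>n. norm (u n)) summable_on {1..}"
    unfolding abs_conv_def u_def of_nat_div_powr by simp
  have v: "(\<lambda>n. norm (v n)) summable_on {1..}"
    using abs_conv_one[OF s] by (simp add: abs_conv_def v_def)
  have bound: "(\<Sum>\<^sub>\<infinity>r\<in>{1..}. norm (h n r / of_nat n powr s)) \<le> C * (\<Sum>q | q dvd n. u q * v (n div q))"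
    if "n \<ge> 1" for n
  proof -
    have "(\<Sum>\<^sub>\<infinity>r\<in>{1..}. norm (h n r / of_nat n powr s)) =
        (\<Sum>\<^sub>\<infinity>r\<in>{1..}. norm (h n r)) * v n"
      by (simp add: v_def norm_mult norm_divide divide_inverse infsum_cmult_left')
    also have "\<dots> \<le> (\<Sum>q | q dvd n. norm (of_nat q / of_nat q powr t :: complex)) * C * v n"
      using inner(3)[OF _ _ that] unfolding h_def C_def v_def by (intro mult_right_mono) auto
    also have "\<dots> = C * (\<Sum>q | q dvd n. norm (of_nat q / of_nat q powr t :: complex) * v n)"
      by (simp add: sum_distrib_right sum_distrib_left mult_ac)
    also have "(\<Sum>q | q dvd n. norm (of_nat q / of_nat q powr t :: complex) * v n) =
        (\<Sum>q | q dvd n. u q * v (n div q))"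
    proof (intro sum.cong refl)
      fix q assume "q \<in> {q. q dvd n}"
      then obtain e where e: "n = q * e" by auto
      with that have "n div q = e" by auto
      then show "norm (of_nat q / of_nat q powr t :: complex) * v n = u q * v (n div q)"
        unfolding u_def v_def e of_nat_mult_powr by (simp add: norm_mult norm_divide)
    qed
    finally show ?thesis .
  qed
  have "(\<lambda>n. C * (\<Sum>q | q dvd n. u q * v (n div q))) summable_on {1..}"
    by (intro summable_on_cmult_right has_sum_imp_summable[OF has_sum_divisor_convolution[OF u v]])
  then have "(\<lambda>n. \<Sum>\<^sub>\<infinity>r\<in>{1..}. norm (h n r / of_nat n powr s)) summable_on {1..}"
    by (rule summable_on_comparison_test) (simp_all only: atLeast_iff bound infsum_nonneg norm_ge_zero)
  moreover have "(\<lambda>r. norm (h n r / of_nat n powr s)) summable_on {1..}" if "n \<ge> 1" for n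
    using h_sum[OF that] unfolding divide_inverse norm_mult by (rule summable_on_cmult_left)
  ultimately show "(\<lambda>(n, r). norm (dft r (f r) n / (of_nat n powr s * of_nat r powr t)))
      summable_on ({1..} \<times> {1..})"
    using Infinite_Sum.abs_summable_on_Sigma_iff[of "\<lambda>(n, r). h n r / of_nat n powr s" "{1..}" "\<lambda>_. {1..}"]
    by (simp add: h case_prod_unfold infsum_nonneg)
  have "(\<Sum>\<^sub>\<infinity>r\<in>{1..}. h n r / of_nat n powr s) =
      dseries F t / zeta t * (divisor_sigma (1 - t) n / of_nat n powr s)" if "n \<ge> 1" for n
  proof -
    have "(\<Sum>\<^sub>\<infinity>r\<in>{1..}. h n r / of_nat n powr s) = (\<Sum>\<^sub>\<infinity>r\<in>{1..}. h n r) / of_nat n powr s"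
      by (simp add: divide_inverse infsum_cmult_left')
    also have "(\<Sum>\<^sub>\<infinity>r\<in>{1..}. h n r) = divisor_sigma (1 - t) n * (dseries F t / zeta t)"
      using inner(2)[OF _ _ that] by (simp add: h_def dseries_def)
    finally show ?thesis by simp
  qed
  then have "(\<Sum>\<^sub>\<infinity>n\<in>{1..}. \<Sum>\<^sub>\<infinity>r\<in>{1..}. h n r / of_nat n powr s) =
      (\<Sum>\<^sub>\<infinity>n\<in>{1..}. dseries F t / zeta t * (divisor_sigma (1 - t) n / of_nat n powr s))"
    by (intro infsum_cong) auto
  also have "\<dots> = dseries F t / zeta t * dseries (divisor_sigma (1 - t)) s"
    unfolding dseries_def by (rule infsum_cmult_right')
  also have "dseries (divisor_sigma (1 - t)) s = zeta s * zeta (s + t - 1)"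
    using s t(1) by (subst dseries_divisor_sigma) (auto simp: algebra_simps)
  finally show "(\<Sum>\<^sub>\<infinity>n\<in>{1..}. \<Sum>\<^sub>\<infinity>r\<in>{1..}. dft r (f r) n / (of_nat n powr s * of_nat r powr t)) =
      zeta s * zeta (s + t - 1) / zeta t * dseries F t"
    by (simp add: h)
qed

theorem proposition11:
  fixes F :: "nat \<Rightarrow> complex" and f :: "nat \<Rightarrow> nat \<Rightarrow> complex"
  assumes f_eq: "\<And>r n. r \<ge> 1 \<Longrightarrow> n \<ge> 1 \<Longrightarrow> f r n = F (gcd n r)"
  shows "(\<forall>n\<ge>1. \<forall>s. ereal (Re s) > max 1 (abs_conv_abscissa F) \<longrightarrow>
            (\<lambda>r. norm (dft r (f r) n / of_nat r powr s)) summable_on {1..} \<and>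
            (\<Sum>\<^sub>\<infinity>r\<in>{1..}. dft r (f r) n / of_nat r powr s) =
              divisor_sigma (s - 1) n / (of_nat n powr (s - 1) * zeta s) *
              (\<Sum>\<^sub>\<infinity>r\<in>{1..}. F r / of_nat r powr s)) \<and>
         (\<forall>r\<ge>1. \<forall>s. Re s > 1 \<longrightarrow>
            (\<lambda>n. norm (dft r (f r) n / of_nat n powr s)) summable_on {1..} \<and>
            (\<Sum>\<^sub>\<infinity>n\<in>{1..}. dft r (f r) n / of_nat n powr s) =
              zeta s * dirichlet_conv F (gen_phi (1 - s)) r) \<and>
         (\<forall>s t. Re s > 1 \<longrightarrow> ereal (Re t) > max 1 (abs_conv_abscissa F) \<longrightarrow>
            (\<lambda>(n, r). norm (dft r (f r) n / (of_nat n powr s * of_nat r powr t)))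
              summable_on ({1..} \<times> {1..}) \<and>
            (\<Sum>\<^sub>\<infinity>n\<in>{1..}. \<Sum>\<^sub>\<infinity>r\<in>{1..}. dft r (f r) n / (of_nat n powr s * of_nat r powr t)) =
              zeta s * zeta (s + t - 1) / zeta t * (\<Sum>\<^sub>\<infinity>n\<in>{1..}. F n / of_nat n powr t))"
proof (intro conjI allI impI)
  have abscissa: "Re s > 1" "abs_conv F s" if "max 1 (abs_conv_abscissa F) < ereal (Re s)" for s
    using that by (auto intro: abs_conv_if_abscissa_less)
  {
    fix n :: nat and s
    assume n: "n \<ge> 1" and s: "max 1 (abs_conv_abscissa F) < ereal (Re s)"
    note period = dseries_dft_period[of f F n s, OF f_eq n abscissa[OF s]]
    show "(\<lambda>r. norm (dft r (f r) n / of_nat r powr s)) summable_on {1..}"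
      using period(1) by (simp add: abs_conv_def)
    show "(\<Sum>\<^sub>\<infinity>r\<in>{1..}. dft r (f r) n / of_nat r powr s) =
        divisor_sigma (s - 1) n / (of_nat n powr (s - 1) * zeta s) *
        (\<Sum>\<^sub>\<infinity>r\<in>{1..}. F r / of_nat r powr s)"
      using period(2) divisor_sigma_reflect[OF n, of "s - 1"] by (simp add: dseries_def)
  next
    fix r :: nat and s :: complex
    assume "r \<ge> 1" and "Re s > 1"
    note frequency = dseries_dft_frequency[of f F r s, OF f_eq this]
    show "(\<lambda>n. norm (dft r (f r) n / of_nat n powr s)) summable_on {1..}"
      using frequency(1) by (simp add: abs_conv_def)
    show "(\<Sum>\<^sub>\<infinity>n\<in>{1..}. dft r (f r) n / of_nat n powr s) =
        zeta s * dirichlet_conv F (gen_phi (1 - s)) r"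
      using frequency(2) by (simp add: dseries_def)
  next
    fix s t
    assume s: "Re s > 1" and t: "max 1 (abs_conv_abscissa F) < ereal (Re t)"
    note double = dseries_dft_double[of f F s t, OF f_eq s abscissa[OF t]]
    show "(\<lambda>(n, r). norm (dft r (f r) n / (of_nat n powr s * of_nat r powr t)))
        summable_on ({1..} \<times> {1..})"
      by (rule double(1))
    show "(\<Sum>\<^sub>\<infinity>n\<in>{1..}. \<Sum>\<^sub>\<infinity>r\<in>{1..}. dft r (f r) n / (of_nat n powr s * of_nat r powr t)) =
        zeta s * zeta (s + t - 1) / zeta t * (\<Sum>\<^sub>\<infinity>n\<in>{1..}. F n / of_nat n powr t)"
      using double(2) by (simp add: dseries_def)
  }
qed

end
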